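(* Let $(\Omega,T,\mu)$ be an invertible dynamical system and let $F\in AC(\Omega,T,\mu)$ be such that $Se(F,T)$ is finite. Then: (i) the process $(F\circ T^n)$ is Markovian if and only if $Se(F,T)=H_2(F)-H_1(F)$; (ii) more generally, for every integer $p\ge1$, the process $(F\circ T^n)$ has memory $p$ if and only if $Se(F,T)=H_{p+1}(F)-H_p(F)$.
   Context: An invertible dynamical system $(\Omega,T,\mu)$ is a probability space $(\Omega,\mu)$ with an invertible measure-preserving transformation $T$. $AC(\Omega,T,\mu)$ denotes the set of real-valued $F\in L^2(\mu)$ such that for every $n\ge 1$ the law $\mu F_n^{-1}$ of $F_n:=(F,F\circ T,\dots,F\circ T^{n-1})$ is absolutely continuous with respect to Lebesgue measure $l^n$ on $\mathbb R^n$. With $\psi(x)=-x\log x$, $\psi(0)=0$ (natural logarithm), set $H_n(F):=\int_{\mathbb R^n}\psi\left(\frac{d\mu F_n^{-1}}{dl^n}\right)dl^n\in[-\infty,\infty)$. The Shannon entropy is $Se(F,T):=\lim_n\frac1nH_n(F)$, which exists in $[-\infty,\infty)$ and equals $\inf_n \frac1n H_n(F)$ (so all $H_n(F)$ are finite when $Se(F,T)$ is). A stationary process $(X_n)$ has memory $p$ if for every $n\ge p$ the conditional law of $X_n$ given $(X_0,\dots,X_{n-1})$ coincides a.s. with its conditional law given $(X_{n-p},\dots,X_{n-1})$; Markovian means memory $1$. *)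

theory Defs
  imports "HOL-Probability.Probability"
begin

definition invertible_dynamical_system :: "'a measure \<Rightarrow> ('a \<Rightarrow> 'a) \<Rightarrow> bool" where
  "invertible_dynamical_system M T \<longleftrightarrow>
     prob_space M \<and>
     bij_betw T (space M) (space M) \<and>
     T \<in> M \<rightarrow>\<^sub>M M \<and>
     the_inv_into (space M) T \<in> M \<rightarrow>\<^sub>M M \<and>
     distr M M T = M"

definition orbit_process :: "('a \<Rightarrow> 'a) \<Rightarrow> ('a \<Rightarrow> real) \<Rightarrow> nat \<Rightarrow> 'a \<Rightarrow> real" where
  "orbit_process T F n = (\<lambda>\<omega>. F ((T ^^ n) \<omega>))"

text \<open>
  Since the dimension varies, \<open>\<real>\<^sup>n\<close> is rendered as the space of extensional functions
  on \<open>{..<n}\<close>, with the product of \<open>n\<close> copies of \<open>lborel\<close> as Lebesgue measure.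
\<close>

abbreviation lborel_pow :: "nat \<Rightarrow> (nat \<Rightarrow> real) measure" where
  "lborel_pow n \<equiv> Pi\<^sub>M {..<n} (\<lambda>_. lborel)"

definition block_law :: "'a measure \<Rightarrow> ('a \<Rightarrow> 'a) \<Rightarrow> ('a \<Rightarrow> real) \<Rightarrow> nat \<Rightarrow> (nat \<Rightarrow> real) measure" where
  "block_law M T F n = distr M (lborel_pow n) (\<lambda>\<omega>. \<lambda>i\<in>{..<n}. orbit_process T F i \<omega>)"

definition AC :: "'a measure \<Rightarrow> ('a \<Rightarrow> 'a) \<Rightarrow> ('a \<Rightarrow> real) set" where
  "AC M T = {F. F \<in> borel_measurable M \<and> integrable M (\<lambda>\<omega>. (F \<omega>)\<^sup>2) \<and>
     (\<forall>n\<ge>1. absolutely_continuous (lborel_pow n) (block_law M T F n))}"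

text \<open>
  The extended integral \<open>\<integral>f\<^sup>+ - \<integral>f\<^sup>-\<close>. When both parts are infinite the value is the
  \<open>ereal\<close> convention \<open>\<infinity> - \<infinity> = \<infinity>\<close>; this does not occur for \<open>H\<close> below, because the second
  moment of \<open>F\<close> makes the positive part of the integrand integrable.
\<close>

definition extended_integral :: "'b measure \<Rightarrow> ('b \<Rightarrow> real) \<Rightarrow> ereal" where
  "extended_integral N f =
     enn2ereal (\<integral>\<^sup>+ x. ennreal (f x) \<partial>N) - enn2ereal (\<integral>\<^sup>+ x. ennreal (- f x) \<partial>N)"

definition psi :: "real \<Rightarrow> real" where
  "psi x = (if x = 0 then 0 else - x * ln x)"

definition H :: "'a measure \<Rightarrow> ('a \<Rightarrow> 'a) \<Rightarrow> nat \<Rightarrow> ('a \<Rightarrow> real) \<Rightarrow> ereal" where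
  "H M T n F = extended_integral (lborel_pow n)
     (\<lambda>x. psi (enn2real (RN_deriv (lborel_pow n) (block_law M T F n) x)))"

definition Se :: "'a measure \<Rightarrow> ('a \<Rightarrow> 'a) \<Rightarrow> ('a \<Rightarrow> real) \<Rightarrow> ereal" where
  "Se M T F = lim (\<lambda>n. H M T n F / ereal (real n))"

definition generated_by :: "'a measure \<Rightarrow> (nat \<Rightarrow> 'a \<Rightarrow> real) \<Rightarrow> nat set \<Rightarrow> 'a measure" where
  "generated_by M X I =
     vimage_algebra (space M) (\<lambda>\<omega>. \<lambda>i\<in>I. X i \<omega>) (Pi\<^sub>M I (\<lambda>_. borel))"

text \<open>
  \<open>K\<close> is a version of the (regular) conditional law of \<open>Y\<close> given the sub-sigma-algebra \<open>G\<close>: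
  a \<open>G\<close>-measurable random probability measure with \<open>K(B) = P(Y \<in> B | G)\<close> a.s. for every Borel
  set \<open>B\<close>. Such versions exist and are a.s. unique for real-valued \<open>Y\<close>;
  hence the choice of \<open>K\<close> and \<open>L\<close> in \<open>has_memory\<close> is immaterial.
\<close>

definition is_cond_law ::
  "'a measure \<Rightarrow> 'a measure \<Rightarrow> ('a \<Rightarrow> real) \<Rightarrow> ('a \<Rightarrow> real measure) \<Rightarrow> bool" where
  "is_cond_law M G Y K \<longleftrightarrow>
     K \<in> G \<rightarrow>\<^sub>M prob_algebra borel \<and>
     (\<forall>B\<in>sets borel. AE \<omega> in M. measure (K \<omega>) B = real_cond_exp M G (indicator (Y -` B)) \<omega>)"

definition has_memory :: "'a measure \<Rightarrow> nat \<Rightarrow> (nat \<Rightarrow> 'a \<Rightarrow> real) \<Rightarrow> bool" where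
  "has_memory M p X \<longleftrightarrow>
     (\<forall>n\<ge>p. \<exists>K L.
        is_cond_law M (generated_by M X {0..<n}) (X n) K \<and>
        is_cond_law M (generated_by M X {n - p..<n}) (X n) L \<and>
        (AE \<omega> in M. K \<omega> = L \<omega>))"

definition Markovian :: "'a measure \<Rightarrow> (nat \<Rightarrow> 'a \<Rightarrow> real) \<Rightarrow> bool" where
  "Markovian M X \<longleftrightarrow> has_memory M 1 X"

end

theory Submission
  imports Defs
begin

text \<open>
  Let \<open>f\<^sub>n\<close> be the density of \<open>(X\<^sub>0, \<dots>, X\<^bsub>n-1\<^esub>)\<close> and
  \<open>d\<^sub>n = H\<^bsub>n+1\<^esub> - H\<^sub>n\<close>. For \<open>p \<le> m\<close>, stationarity expresses \<open>d\<^sub>p - d\<^sub>m\<close> as the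
  relative entropy of \<open>f\<^bsub>m+1\<^esub>\<close> with respect to the probability density
  \<open>q(x) = f\<^sub>m(x\<^sub>0, \<dots>, x\<^bsub>m-1\<^esub>) f\<^bsub>p+1\<^esub>(x\<^bsub>m-p\<^esub>, \<dots>, x\<^sub>m) / f\<^sub>p(x\<^bsub>m-p\<^esub>, \<dots>, x\<^bsub>m-1\<^esub>)\<close>.
  Hence \<open>d\<close> is nonincreasing, its limit is the limit of \<open>H\<^sub>n / n\<close>, and this limit equals \<open>d\<^sub>p\<close>
  exactly if \<open>f\<^bsub>m+1\<^esub> = q\<close> almost everywhere for all \<open>m \<ge> p\<close>. The latter says that the conditional
  density of \<open>X\<^sub>m\<close> given the whole past is its conditional density given the last \<open>p\<close> values.
\<close>

section \<open>Lebesgue measure on finite powers of the line and windows of coordinates\<close>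

interpretation lborel_product: product_sigma_finite "\<lambda>_::nat. lborel :: real measure"
  by unfold_locales

lemma sigma_finite_lborel_pow: "sigma_finite_measure (lborel_pow n)"
  by (rule lborel_product.sigma_finite) simp

lemma nn_integral_lborel_pow_Suc:
  assumes "g \<in> borel_measurable (lborel_pow (Suc n))"
  shows "(\<integral>\<^sup>+x. g x \<partial>lborel_pow (Suc n)) = (\<integral>\<^sup>+x. (\<integral>\<^sup>+y. g (x(n := y)) \<partial>lborel) \<partial>lborel_pow n)"
  using assms unfolding lessThan_Suc by (intro lborel_product.product_nn_integral_insert) auto

lemma fun_upd_measurable_lborel_pow [measurable]:
  assumes "z \<in> N \<rightarrow>\<^sub>M lborel_pow n" "y \<in> borel_measurable N"
  shows "(\<lambda>x. (z x)(n := y x)) \<in> N \<rightarrow>\<^sub>M lborel_pow (Suc n)"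
  by (rule measurable_fun_upd[OF _ assms(1)]) (use assms(2) in auto)

text \<open>The coordinates are renumbered from 0, so that \<open>f n\<close> can be applied to any
  stretch of \<open>n\<close> consecutive ones.\<close>

definition window :: "nat \<Rightarrow> nat \<Rightarrow> (nat \<Rightarrow> real) \<Rightarrow> nat \<Rightarrow> real" where
  "window k n x = (\<lambda>i\<in>{..<n}. x (k + i))"

lemma window_measurable:
  assumes "k + m \<le> n"
  shows "window k m \<in> lborel_pow n \<rightarrow>\<^sub>M lborel_pow m"
  unfolding window_def by (rule measurable_restrict, rule measurable_component_singleton) (use assms in auto)

lemma window_fun_upd_last:
  "k + n = m \<Longrightarrow> window k n (x(m := y)) = window k n x"
  by (auto simp: window_def fun_eq_iff)

lemma window_Suc_fun_upd_last:
  "k + n = m \<Longrightarrow> window k (Suc n) (x(m := y)) = (window k n x)(n := y)"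
  by (auto simp: window_def fun_eq_iff)

lemma window_0: "x \<in> space (lborel_pow m) \<Longrightarrow> window 0 m x = x"
  by (auto simp: window_def fun_eq_iff space_PiM PiE_def extensional_def)

section \<open>Integrals of logarithms and the Gibbs inequality\<close>

lemma nn_integral_ln_finite:
  fixes R :: "'a \<Rightarrow> real"
  assumes [measurable]: "R \<in> borel_measurable M" and "AE x in M. 0 < R x"
    and le: "(\<integral>\<^sup>+x. ennreal (R x) \<partial>M) \<le> 1"
  shows "(\<integral>\<^sup>+x. ennreal (ln (R x)) \<partial>M) < \<infinity>"
proof -
  \<comment> \<open>\<open>ennreal\<close> sends negative numbers to 0, so only the positive part of
    the logarithm is integrated here, and it lies below \<open>R\<close>.\<close>
  have "(\<integral>\<^sup>+x. ennreal (ln (R x)) \<partial>M) \<le> (\<integral>\<^sup>+x. ennreal (R x) \<partial>M)"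
    by (rule nn_integral_mono_AE) (use assms(2) in eventually_elim, auto intro!: ennreal_leI ln_bound)
  also have "\<dots> \<le> 1" by (rule le)
  finally show ?thesis by (auto simp: less_top[symmetric] top_unique)
qed

text \<open>Integrate \<open>ln r <= r - 1\<close>, which is an equality only at
  \<open>r = 1\<close>. In the application \<open>R\<close> is a quotient of two densities along the
  process, and minus the integral of \<open>ln R\<close> is a relative entropy. The mass of
  \<open>R\<close> may be below 1, since the numerator can charge zeros of the denominator.\<close>

lemma (in prob_space) integral_ln_nonpos:
  fixes R :: "'a \<Rightarrow> real"
  assumes [measurable]: "R \<in> borel_measurable M" and pos: "AE x in M. 0 < R x"
    and le: "(\<integral>\<^sup>+x. ennreal (R x) \<partial>M) \<le> 1"
    and int: "integrable M (\<lambda>x. ln (R x))"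
  shows "(\<integral>x. ln (R x) \<partial>M) \<le> 0"
    and "(\<integral>x. ln (R x) \<partial>M) = 0 \<longleftrightarrow> (AE x in M. R x = 1)"
proof -
  have intR: "integrable M R"
  proof (rule integrableI_nonneg)
    show "AE x in M. 0 \<le> R x" using pos by eventually_elim auto
    show "(\<integral>\<^sup>+x. ennreal (R x) \<partial>M) < \<infinity>" using le by (auto simp: less_top[symmetric] top_unique)
  qed simp
  have "ennreal (\<integral>x. R x \<partial>M) = (\<integral>\<^sup>+x. ennreal (R x) \<partial>M)"
    by (rule nn_integral_eq_integral[symmetric]) (use intR pos in \<open>auto elim: eventually_mono\<close>)
  with le have "ennreal (\<integral>x. R x \<partial>M) \<le> ennreal 1" by simp
  then have R1: "(\<integral>x. R x \<partial>M) \<le> 1" by (subst (asm) ennreal_le_iff) auto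
  \<comment> \<open>The nonnegative slack in \<open>ln r <= r - 1\<close>. If \<open>ln R\<close>
    integrates to 0, then \<open>D\<close> integrates to at most 0 and thus vanishes almost
    everywhere.\<close>
  define D where "D x = R x - 1 - ln (R x)" for x
  have intD: "integrable M D" unfolding D_def using intR int by simp
  have D0: "AE x in M. 0 \<le> D x"
    using pos by eventually_elim (simp add: D_def ln_le_minus_one)
  have ED: "(\<integral>x. D x \<partial>M) = (\<integral>x. R x \<partial>M) - 1 - (\<integral>x. ln (R x) \<partial>M)"
    unfolding D_def using intR int by (simp add: prob_space)
  have ED0: "0 \<le> (\<integral>x. D x \<partial>M)" using D0 by (rule integral_nonneg_AE)
  then show "(\<integral>x. ln (R x) \<partial>M) \<le> 0" using ED R1 by linarith
  show "(\<integral>x. ln (R x) \<partial>M) = 0 \<longleftrightarrow> (AE x in M. R x = 1)"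
  proof
    assume "(\<integral>x. ln (R x) \<partial>M) = 0"
    then have "(\<integral>x. D x \<partial>M) = 0" using ED ED0 R1 by linarith
    then have "AE x in M. D x = 0" using integral_nonneg_eq_0_iff_AE[OF intD D0] by simp
    with pos show "AE x in M. R x = 1"
      by eventually_elim (auto simp: D_def intro: ln_eq_minus_one)
  next
    assume "AE x in M. R x = 1"
    then have "AE x in M. ln (R x) = 0" by eventually_elim simp
    then show "(\<integral>x. ln (R x) \<partial>M) = 0" by (rule integral_eq_zero_AE)
  qed
qed

section \<open>Sequences with nonincreasing increments\<close>

text \<open>From \<open>m\<close> on, \<open>h\<close> stays below the line of slope
  \<open>d m\<close> through \<open>(m, h m)\<close>, so the limit of the means is at most every
  \<open>d m\<close>. Convergence has to be established first, since \<open>lim\<close> carries no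
  information without it; it takes place in \<open>ereal\<close> because the limit may be minus
  infinity.\<close>

lemma lim_mean_eq_increment_iff:
  fixes h :: "nat \<Rightarrow> real"
  assumes concave: "\<And>n. h (Suc (Suc n)) - h (Suc n) \<le> h (Suc n) - h n"
  shows "lim (\<lambda>n. ereal (h n) / ereal (real n)) = ereal (h (Suc p) - h p) \<longleftrightarrow>
    (\<forall>n\<ge>p. h (Suc n) - h n = h (Suc p) - h p)"
proof -
  define d where "d n = h (Suc n) - h n" for n
  have dec: "decseq d" using concave by (intro decseq_SucI) (simp add: d_def)
  have dle: "d n \<le> d m" if "m \<le> n" for m n using dec that by (simp add: decseq_def)
  have lim0: "(\<lambda>n. ereal (c / real (Suc n))) \<longlonglongrightarrow> ereal 0" for c :: real
    unfolding lim_ereal by (rule LIMSEQ_Suc[OF lim_const_over_n])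
  have Suc_div: "ereal (h (Suc n)) / ereal (real (Suc n)) = ereal (h (Suc n) / real (Suc n))" for n
    by simp
  have hle: "h n \<le> h m + (real n - real m) * d m" if "m \<le> n" for m n
    using that
  proof (induction n rule: dec_induct)
    case (step n)
    have "h (Suc n) = h n + d n" by (simp add: d_def)
    also have "\<dots> \<le> h m + (real n - real m) * d m + d m" using step dle[of m n] by simp
    finally show ?case by (simp add: algebra_simps)
  qed simp
  have heq: "h n = h m + (real n - real m) * d m" if "\<forall>n\<ge>m. d n = d m" "m \<le> n" for m n
    using that(2)
  proof (induction n rule: dec_induct)
    case (step n)
    have "h (Suc n) = h n + d n" by (simp add: d_def)
    moreover have "d n = d m" using step.hyps that(1) by blast
    ultimately show ?case using step.IH by (simp add: algebra_simps)
  qed simp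
  have line: "(\<lambda>n. ereal ((c + (real (Suc n) - real m) * e) / real (Suc n))) \<longlonglongrightarrow> ereal e" for c e m
  proof -
    have "(\<lambda>n. (c - real m * e) / real (Suc n) + e) \<longlonglongrightarrow> 0 + e"
      by (intro tendsto_add tendsto_const LIMSEQ_Suc[OF lim_const_over_n])
    moreover have "(c - real m * e) / real (Suc n) + e = (c + (real (Suc n) - real m) * e) / real (Suc n)" for n
      by (simp add: field_simps del: of_nat_Suc)
    ultimately show ?thesis by simp
  qed
  \<comment> \<open>The slope of the chord of \<open>h\<close> from 0 to \<open>n + 1\<close>.
    Concavity makes these slopes nonincreasing, hence convergent in \<open>ereal\<close>; the shift
    by one keeps the denominator positive.\<close>
  define a where "a n = (h (Suc n) - h 0) / real (Suc n)" for n
  have "decseq (\<lambda>n. ereal (a n))"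
  proof (rule decseq_SucI)
    fix n
    \<comment> \<open>The line of slope \<open>d k\<close> through \<open>(k, h k)\<close> is above
      \<open>h\<close> at 0 as well.\<close>
    have *: "h 0 \<le> h k - real k * d k" for k
    proof (induction k)
      case (Suc k)
      have "h (Suc k) = h k + d k" by (simp add: d_def)
      moreover have "real (Suc k) * d (Suc k) \<le> real (Suc k) * d k" 
        using dle[of k "Suc k"] by (intro mult_left_mono) auto
      ultimately show ?case using Suc by (simp add: algebra_simps)
    qed simp
    have "h (Suc (Suc n)) = h (Suc n) + d (Suc n)" by (simp add: d_def)
    with *[of "Suc n"] have "(h (Suc (Suc n)) - h 0) * real (Suc n) \<le> (h (Suc n) - h 0) * real (Suc (Suc n))"
      by (simp add: algebra_simps)
    then show "ereal (a (Suc n)) \<le> ereal (a n)" unfolding a_def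
      by (simp add: divide_simps split: if_splits del: of_nat_Suc)
  qed
  then have "(\<lambda>n. ereal (a n)) \<longlonglongrightarrow> (INF n. ereal (a n))" by (rule LIMSEQ_INF)
  then have "(\<lambda>n. ereal (a n) + ereal (h 0 / real (Suc n))) \<longlonglongrightarrow> (INF n. ereal (a n)) + ereal 0"
    by (intro tendsto_add_ereal_general[OF _ _ lim0]) simp_all
  moreover have "ereal (a n) + ereal (h 0 / real (Suc n)) = ereal (h (Suc n)) / ereal (real (Suc n))" for n
    by (simp add: a_def diff_divide_distrib)
  ultimately obtain l where "(\<lambda>n. ereal (h (Suc n)) / ereal (real (Suc n))) \<longlonglongrightarrow> l" by auto
  then have conv: "(\<lambda>n. ereal (h n) / ereal (real n)) \<longlonglongrightarrow> l" by (rule LIMSEQ_imp_Suc)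
  then have lim: "lim (\<lambda>n. ereal (h n) / ereal (real n)) = l" by (rule limI)
  have l_le: "l \<le> ereal (d m)" for m
  proof (rule LIMSEQ_le[OF LIMSEQ_Suc[OF conv] line[of "h m" m "d m"]])
    show "\<exists>N. \<forall>n\<ge>N. ereal (h (Suc n)) / ereal (real (Suc n)) \<le>
        ereal ((h m + (real (Suc n) - real m) * d m) / real (Suc n))"
      unfolding Suc_div using hle[of m "Suc n" for n]
      by (intro exI[of _ m]) (auto intro!: divide_right_mono simp del: of_nat_Suc)
  qed
  have "l = ereal (d p) \<longleftrightarrow> (\<forall>n\<ge>p. d n = d p)"
  proof
    assume "l = ereal (d p)"
    \<comment> \<open>For \<open>n >= p\<close>, the chain is
      \<open>d p = l <= d n <= d p\<close>.\<close>
    then show "\<forall>n\<ge>p. d n = d p" using l_le dle by (metis antisym ereal_less_eq(3))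
  next
    assume const: "\<forall>n\<ge>p. d n = d p"
    have "(\<lambda>n. ereal (h (Suc n)) / ereal (real (Suc n))) \<longlonglongrightarrow> ereal (d p)"
    proof (rule Lim_transform_eventually[OF line[of "h p" p "d p"]])
      show "\<forall>\<^sub>F n in sequentially. ereal ((h p + (real (Suc n) - real p) * d p) / real (Suc n)) =
          ereal (h (Suc n)) / ereal (real (Suc n))"
        unfolding Suc_div using heq[OF const, of "Suc n" for n]
        by (intro eventually_sequentiallyI[of p]) (simp del: of_nat_Suc)
    qed
    then show "l = ereal (d p)" using LIMSEQ_unique LIMSEQ_Suc[OF conv] by blast
  qed
  then show ?thesis unfolding lim d_def .
qed

text \<open>The positive part of a sum is at most the sum of the positive parts. This moves
  integrable terms across a one-sided bound while the negative part of \<open>a\<close> may still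
  have infinite integral.\<close>

lemma nn_integral_le_add_finite:
  assumes [measurable]: "a \<in> borel_measurable M" "b \<in> borel_measurable M" "c \<in> borel_measurable M"
    and "\<And>\<omega>. c \<omega> = a \<omega> + b \<omega>"
    and "(\<integral>\<^sup>+\<omega>. ennreal (a \<omega>) \<partial>M) < \<infinity>" and "integrable M b"
  shows "(\<integral>\<^sup>+\<omega>. ennreal (c \<omega>) \<partial>M) < \<infinity>"
proof -
  have "(\<integral>\<^sup>+\<omega>. ennreal (c \<omega>) \<partial>M) \<le> (\<integral>\<^sup>+\<omega>. ennreal (a \<omega>) + ennreal (b \<omega>) \<partial>M)"
    using assms(4) by (intro nn_integral_mono) (simp add: ennreal_plus_if ennreal_leI)
  also have "\<dots> = (\<integral>\<^sup>+\<omega>. ennreal (a \<omega>) \<partial>M) + (\<integral>\<^sup>+\<omega>. ennreal (b \<omega>) \<partial>M)"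
    by (rule nn_integral_add) measurable
  also have "\<dots> < \<infinity>"
    using assms(5,6) by (auto simp: real_integrable_def less_top)
  finally show ?thesis .
qed

lemma ln_std_normal_density: "ln (std_normal_density x) = - x\<^sup>2 / 2 - ln (sqrt (2 * pi))"
  by (simp add: std_normal_density_def ln_mult ln_div)

lemma nn_integral_std_normal: "(\<integral>\<^sup>+x. ennreal (std_normal_density x) \<partial>lborel) = 1"
  using prob_space.emeasure_space_1[OF prob_space_normal_density[of 1 0]] by (simp add: emeasure_density)

section \<open>Processes with stationary block densities\<close>

text \<open>The transformation is abstracted away: \<open>distr_block\<close> holds for every
  starting time \<open>k\<close> with the same \<open>f n\<close>, and so expresses both
  stationarity and the existence of block densities.\<close>

locale stationary_density_process = prob_space M for M :: "'a measure" +
  fixes X :: "nat \<Rightarrow> 'a \<Rightarrow> real" and f :: "nat \<Rightarrow> (nat \<Rightarrow> real) \<Rightarrow> real"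
  assumes X_measurable [measurable]: "X i \<in> borel_measurable M"
    and f_measurable [measurable]: "f n \<in> borel_measurable (lborel_pow n)"
    and square_integrable: "integrable M (\<lambda>\<omega>. (X i \<omega>)\<^sup>2)"
    and f_nonneg: "0 \<le> f n x"
    and distr_block: "distr M (lborel_pow n) (\<lambda>\<omega>. \<lambda>i\<in>{..<n}. X (k + i) \<omega>) =
      density (lborel_pow n) (\<lambda>x. ennreal (f n x))"
begin

definition block :: "nat \<Rightarrow> nat \<Rightarrow> 'a \<Rightarrow> nat \<Rightarrow> real" where
  "block k n \<omega> = (\<lambda>i\<in>{..<n}. X (k + i) \<omega>)"

lemma block_measurable [measurable]: "block k n \<in> M \<rightarrow>\<^sub>M lborel_pow n"
  unfolding block_def by measurable

lemma window_block: "j + m \<le> n \<Longrightarrow> window j m (block k n \<omega>) = block (k + j) m \<omega>"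
  by (auto simp: window_def block_def fun_eq_iff add.assoc)

lemma distr_eq_density: "distr M (lborel_pow n) (block k n) = density (lborel_pow n) (\<lambda>x. ennreal (f n x))"
  unfolding block_def[abs_def] by (rule distr_block)

lemma nn_integral_block:
  assumes [measurable]: "g \<in> borel_measurable (lborel_pow n)"
  shows "(\<integral>\<^sup>+\<omega>. g (block k n \<omega>) \<partial>M) = (\<integral>\<^sup>+x. ennreal (f n x) * g x \<partial>lborel_pow n)"
proof -
  have "(\<integral>\<^sup>+\<omega>. g (block k n \<omega>) \<partial>M) = (\<integral>\<^sup>+x. g x \<partial>distr M (lborel_pow n) (block k n))"
    by (simp add: nn_integral_distr)
  also have "distr M (lborel_pow n) (block k n) = density (lborel_pow n) (\<lambda>x. ennreal (f n x))"
    by (rule distr_eq_density)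
  finally show ?thesis by (simp add: nn_integral_density)
qed

text \<open>The law of a block does not see the zeros of \<open>f n\<close>, whence the guard
  \<open>0 < f n x\<close>. \<open>AE_eq_f\<close> removes this guard when two probability densities
  are compared.\<close>

lemma AE_block_iff:
  assumes [measurable]: "Measurable.pred (lborel_pow n) P"
  shows "(AE \<omega> in M. P (block k n \<omega>)) \<longleftrightarrow> (AE x in lborel_pow n. 0 < f n x \<longrightarrow> P x)"
proof -
  have "(AE \<omega> in M. P (block k n \<omega>)) \<longleftrightarrow> (AE x in distr M (lborel_pow n) (block k n). P x)"
    by (rule AE_distr_iff[symmetric]) measurable
  also have "\<dots> \<longleftrightarrow> (AE x in lborel_pow n. 0 < f n x \<longrightarrow> P x)"
    unfolding distr_eq_density by (subst AE_density) simp_all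
  finally show ?thesis .
qed

lemma f_block_pos: "AE \<omega> in M. 0 < f n (block k n \<omega>)"
  by (subst AE_block_iff) auto

lemma nn_integral_f: "(\<integral>\<^sup>+x. ennreal (f n x) \<partial>lborel_pow n) = 1"
  using nn_integral_block[of "\<lambda>_. 1" n 0] by (simp add: emeasure_space_1)

text \<open>Both sides are densities of the law of the first \<open>n\<close> variables, and
  densities are unique almost everywhere.\<close>

lemma nn_integral_f_Suc: "AE z in lborel_pow n. (\<integral>\<^sup>+y. ennreal (f (Suc n) (z(n := y))) \<partial>lborel) = ennreal (f n z)"
proof -
  interpret L: sigma_finite_measure "lborel_pow n" by (rule sigma_finite_lborel_pow)
  let ?g = "\<lambda>z. \<integral>\<^sup>+y. ennreal (f (Suc n) (z(n := y))) \<partial>lborel"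
  have "density (lborel_pow n) ?g = density (lborel_pow n) (\<lambda>x. ennreal (f n x))"
  proof (rule measure_eqI)
    fix A assume "A \<in> sets (density (lborel_pow n) ?g)"
    then have [measurable]: "A \<in> sets (lborel_pow n)" by simp
    have [measurable]: "window 0 n \<in> lborel_pow (Suc n) \<rightarrow>\<^sub>M lborel_pow n" by (rule window_measurable) simp
    have "emeasure (density (lborel_pow n) ?g) A = (\<integral>\<^sup>+z. ?g z * indicator A z \<partial>lborel_pow n)"
      by (rule emeasure_density) measurable
    also have "\<dots> = (\<integral>\<^sup>+z. (\<integral>\<^sup>+y. ennreal (f (Suc n) (z(n := y))) * indicator A z \<partial>lborel) \<partial>lborel_pow n)"
      by (intro nn_integral_cong nn_integral_multc[symmetric]) measurable
    also have "\<dots> = (\<integral>\<^sup>+z. (\<integral>\<^sup>+y. ennreal (f (Suc n) (z(n := y))) * indicator A (window 0 n (z(n := y))) \<partial>lborel) \<partial>lborel_pow n)"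
      by (intro nn_integral_cong) (simp add: window_fun_upd_last window_0)
    also have "\<dots> = (\<integral>\<^sup>+x. ennreal (f (Suc n) x) * indicator A (window 0 n x) \<partial>lborel_pow (Suc n))"
      by (rule nn_integral_lborel_pow_Suc[symmetric]) measurable
    also have "\<dots> = (\<integral>\<^sup>+\<omega>. indicator A (window 0 n (block 0 (Suc n) \<omega>)) \<partial>M)"
      by (rule nn_integral_block[symmetric]) measurable
    also have "\<dots> = (\<integral>\<^sup>+\<omega>. indicator A (block 0 n \<omega>) \<partial>M)"
      by (simp add: window_block)
    also have "\<dots> = (\<integral>\<^sup>+x. ennreal (f n x) * indicator A x \<partial>lborel_pow n)"
      by (rule nn_integral_block) measurable
    also have "\<dots> = emeasure (density (lborel_pow n) (\<lambda>x. ennreal (f n x))) A"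
      by (rule emeasure_density[symmetric]) measurable
    finally show "emeasure (density (lborel_pow n) ?g) A = emeasure (density (lborel_pow n) (\<lambda>x. ennreal (f n x))) A" .
  qed simp
  then show ?thesis by (subst (asm) L.density_unique_iff) measurable
qed

section \<open>Conditional densities given the last \<open>p\<close> values\<close>

text \<open>The points at which dividing by \<open>f p z\<close> yields a genuine probability
  density in the next variable. Blocks of the process are almost surely of this kind.\<close>

definition conditionable :: "nat \<Rightarrow> (nat \<Rightarrow> real) \<Rightarrow> bool" where
  "conditionable p z \<longleftrightarrow> 0 < f p z \<and> (\<integral>\<^sup>+y. ennreal (f (Suc p) (z(p := y))) \<partial>lborel) = ennreal (f p z)"

lemma conditionable_measurable [measurable]: "Measurable.pred (lborel_pow p) (conditionable p)"
proof -
  have [measurable]: "(\<lambda>z. \<integral>\<^sup>+y. ennreal (f (Suc p) (z(p := y))) \<partial>lborel) \<in> borel_measurable (lborel_pow p)"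
    by measurable
  show ?thesis unfolding conditionable_def order.eq_iff not_less[symmetric] by measurable
qed

lemma conditionable_block: "AE \<omega> in M. conditionable p (block k p \<omega>)"
  using nn_integral_f_Suc[of p] by (subst AE_block_iff[OF conditionable_measurable]) (auto simp: conditionable_def)

text \<open>A version of the conditional law of the next variable given that the last
  \<open>p\<close> values are \<open>z\<close>. The point mass at 0 is a default that keeps every
  value a probability measure, as \<open>is_cond_law\<close> demands.\<close>

definition kernel :: "nat \<Rightarrow> (nat \<Rightarrow> real) \<Rightarrow> real measure" where
  "kernel p z = (if conditionable p z then density lborel (\<lambda>y. ennreal (f (Suc p) (z(p := y)) / f p z)) else return borel 0)"

lemma emeasure_kernel:
  assumes "z \<in> space (lborel_pow p)" and "B \<in> sets borel"
  shows "emeasure (kernel p z) B = (if conditionable p z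
    then \<integral>\<^sup>+y. ennreal (f (Suc p) (z(p := y)) / f p z) * indicator B y \<partial>lborel else indicator B 0)"
proof -
  have [measurable]: "(\<lambda>y. f (Suc p) (z(p := y))) \<in> borel_measurable borel"
    by (rule measurable_compose[OF _ f_measurable]) (use assms(1) in measurable)
  show ?thesis using assms(2) by (simp add: kernel_def emeasure_density)
qed

lemma prob_space_kernel:
  assumes "z \<in> space (lborel_pow p)"
  shows "prob_space (kernel p z)"
proof (cases "conditionable p z")
  case True
  have [measurable]: "(\<lambda>y. f (Suc p) (z(p := y))) \<in> borel_measurable borel"
    by (rule measurable_compose[OF _ f_measurable]) (use assms(1) in measurable)
  have "emeasure (kernel p z) UNIV = (\<integral>\<^sup>+y. ennreal (f (Suc p) (z(p := y))) / ennreal (f p z) \<partial>lborel)"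
    using assms True by (simp add: emeasure_kernel divide_ennreal f_nonneg conditionable_def)
  also have "\<dots> = (\<integral>\<^sup>+y. ennreal (f (Suc p) (z(p := y))) \<partial>lborel) / ennreal (f p z)"
    by (rule nn_integral_divide) measurable
  also have "\<dots> = 1"
    using True by (simp add: conditionable_def ennreal_divide_self)
  finally show ?thesis by (intro prob_spaceI) (simp add: kernel_def True)
qed (simp add: kernel_def prob_space_return)

lemma kernel_measurable [measurable]: "kernel p \<in> lborel_pow p \<rightarrow>\<^sub>M prob_algebra borel"
proof (rule measurable_prob_algebraI[OF prob_space_kernel measurable_subprob_algebra])
  fix B :: "real set" assume [measurable]: "B \<in> sets borel"
  have "(\<lambda>z. if conditionable p z then \<integral>\<^sup>+y. ennreal (f (Suc p) (z(p := y)) / f p z) * indicator B y \<partial>lborel 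
      else indicator B 0) \<in> borel_measurable (lborel_pow p)"
    by measurable
  then show "(\<lambda>z. emeasure (kernel p z) B) \<in> borel_measurable (lborel_pow p)"
    by (subst measurable_cong[OF emeasure_kernel]) auto
qed (simp_all add: prob_space_kernel prob_space_imp_subprob_space, simp add: kernel_def)

text \<open>The joint density of \<open>m + 1\<close> consecutive variables if the last one depended on the
  others only through its \<open>p\<close> predecessors.\<close>

definition memory_density :: "nat \<Rightarrow> nat \<Rightarrow> (nat \<Rightarrow> real) \<Rightarrow> real" where
  "memory_density p m x = f m (window 0 m x) * (f (Suc p) (window (m - p) (Suc p) x) / f p (window (m - p) p x))"

lemma memory_density_nonneg: "0 \<le> memory_density p m x"
  by (simp add: memory_density_def f_nonneg)

lemma memory_density_measurable [measurable]:
  assumes "p \<le> m"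
  shows "memory_density p m \<in> borel_measurable (lborel_pow (Suc m))"
proof -
  have [measurable]: "window 0 m \<in> lborel_pow (Suc m) \<rightarrow>\<^sub>M lborel_pow m"
    "window (m - p) (Suc p) \<in> lborel_pow (Suc m) \<rightarrow>\<^sub>M lborel_pow (Suc p)"
    "window (m - p) p \<in> lborel_pow (Suc m) \<rightarrow>\<^sub>M lborel_pow p"
    by (rule window_measurable, use assms in simp)+
  show ?thesis unfolding memory_density_def by measurable
qed

text \<open>By Tonelli, drawing \<open>m\<close> variables with density \<open>f m\<close> and then
  the next one from the kernel at the last \<open>p\<close> of them produces the joint density
  \<open>memory_density p m\<close>.\<close>

lemma nn_integral_kernel:
  assumes pm: "p \<le> m" and [measurable]: "A \<in> sets (lborel_pow m)" "B \<in> sets borel"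
  shows "(\<integral>\<^sup>+\<omega>. indicator A (block j m \<omega>) * emeasure (kernel p (block (j + (m - p)) p \<omega>)) B \<partial>M) =
    (\<integral>\<^sup>+x. ennreal (memory_density p m x) * (indicator A (window 0 m x) * indicator B (x m)) \<partial>lborel_pow (Suc m))"
proof -
  have [measurable]: "window 0 m \<in> lborel_pow (Suc m) \<rightarrow>\<^sub>M lborel_pow m"
    "window (m - p) p \<in> lborel_pow m \<rightarrow>\<^sub>M lborel_pow p"
    by (rule window_measurable, use pm in simp)+
  let ?w = "window (m - p) p"
  let ?g = "\<lambda>z. \<integral>\<^sup>+y. ennreal (f (Suc p) (z(p := y)) / f p z) * indicator B y \<partial>lborel"
  have "(\<integral>\<^sup>+\<omega>. indicator A (block j m \<omega>) * emeasure (kernel p (block (j + (m - p)) p \<omega>)) B \<partial>M) =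
      (\<integral>\<^sup>+\<omega>. indicator A (block j m \<omega>) * ?g (?w (block j m \<omega>)) \<partial>M)"
  \<comment> \<open>The block is almost surely \<open>conditionable\<close>, so the default branch
    of the kernel does not contribute.\<close>
  proof (rule nn_integral_cong_AE)
    show "AE \<omega> in M. indicator A (block j m \<omega>) * emeasure (kernel p (block (j + (m - p)) p \<omega>)) B =
        indicator A (block j m \<omega>) * ?g (?w (block j m \<omega>))"
      using conditionable_block[of p "j + (m - p)"] AE_space
    proof eventually_elim
      case (elim \<omega>)
      have "block (j + (m - p)) p \<omega> \<in> space (lborel_pow p)"
        by (rule measurable_space[OF block_measurable]) fact
      with elim show ?case using pm by (simp add: window_block emeasure_kernel)
    qed
  qed
  also have "\<dots> = (\<integral>\<^sup>+x. ennreal (f m x) * (indicator A x * ?g (?w x)) \<partial>lborel_pow m)"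
    by (rule nn_integral_block) measurable
  also have "\<dots> = (\<integral>\<^sup>+x. (\<integral>\<^sup>+y. ennreal (memory_density p m (x(m := y))) * 
      (indicator A (window 0 m (x(m := y))) * indicator B y) \<partial>lborel) \<partial>lborel_pow m)"
  proof (rule nn_integral_cong)
    fix x assume x: "x \<in> space (lborel_pow m)"
    then have "?w x \<in> space (lborel_pow p)" by (rule measurable_space[rotated]) measurable
    then have [measurable]: "(\<lambda>y. f (Suc p) ((?w x)(p := y))) \<in> borel_measurable borel"
      by (intro measurable_compose[OF _ f_measurable]) measurable
    have "ennreal (f m x) * (indicator A x * ?g (?w x)) =
        (\<integral>\<^sup>+y. ennreal (f m x) * (indicator A x * (ennreal (f (Suc p) ((?w x)(p := y)) / f p (?w x)) * indicator B y)) \<partial>lborel)"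
      by (simp add: nn_integral_cmult)
    also have "\<dots> = (\<integral>\<^sup>+y. ennreal (memory_density p m (x(m := y))) * 
      (indicator A (window 0 m (x(m := y))) * indicator B y) \<partial>lborel)"
      using x pm by (intro nn_integral_cong)
        (simp add: memory_density_def window_fun_upd_last window_Suc_fun_upd_last window_0 f_nonneg ennreal_mult mult_ac del: times_divide_eq_right times_divide_eq_left)
    finally show "ennreal (f m x) * (indicator A x * ?g (?w x)) = (\<integral>\<^sup>+y. ennreal (memory_density p m (x(m := y))) * 
      (indicator A (window 0 m (x(m := y))) * indicator B y) \<partial>lborel)" .
  qed
  also have "\<dots> = (\<integral>\<^sup>+x. ennreal (memory_density p m x) * (indicator A (window 0 m x) * indicator B (x m)) \<partial>lborel_pow (Suc m))"
    using memory_density_measurable[OF pm] by (subst nn_integral_lborel_pow_Suc) simp_all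
  finally show ?thesis .
qed

text \<open>Take the whole spaces for \<open>A\<close> and \<open>B\<close> in
  \<open>nn_integral_kernel\<close>; the kernel has total mass 1 at every block.\<close>

lemma nn_integral_memory_density:
  assumes pm: "p \<le> m"
  shows "(\<integral>\<^sup>+x. ennreal (memory_density p m x) \<partial>lborel_pow (Suc m)) = 1"
proof -
  have [measurable]: "window 0 m \<in> lborel_pow (Suc m) \<rightarrow>\<^sub>M lborel_pow m"
    by (rule window_measurable) simp
  have "(\<integral>\<^sup>+x. ennreal (memory_density p m x) \<partial>lborel_pow (Suc m)) =
      (\<integral>\<^sup>+x. ennreal (memory_density p m x) * (indicator (space (lborel_pow m)) (window 0 m x) * indicator UNIV (x m)) \<partial>lborel_pow (Suc m))"
    by (intro nn_integral_cong) (auto simp: indicator_def dest: measurable_space[OF window_measurable[of 0 m "Suc m"], rotated])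
  also have "\<dots> = (\<integral>\<^sup>+\<omega>. indicator (space (lborel_pow m)) (block 0 m \<omega>) * emeasure (kernel p (block (0 + (m - p)) p \<omega>)) UNIV \<partial>M)"
    using pm by (intro nn_integral_kernel[symmetric]) auto
  also have "\<dots> = (\<integral>\<^sup>+\<omega>. 1 \<partial>M)"
  proof (rule nn_integral_cong)
    fix \<omega> assume \<omega>: "\<omega> \<in> space M"
    interpret K: prob_space "kernel p (block (0 + (m - p)) p \<omega>)"
      by (rule prob_space_kernel[OF measurable_space[OF block_measurable \<omega>]])
    have "space (kernel p (block (0 + (m - p)) p \<omega>)) = UNIV" by (auto simp: kernel_def)
    then show "indicator (space (lborel_pow m)) (block 0 m \<omega>) * emeasure (kernel p (block (0 + (m - p)) p \<omega>)) UNIV = 1"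
      using K.emeasure_space_1 measurable_space[OF block_measurable \<omega>, of 0 m] by simp
  qed
  finally show ?thesis by (simp add: emeasure_space_1)
qed

subsection \<open>Conditional laws and memory\<close>

text \<open>On the set where \<open>f n\<close> is positive, \<open>q\<close> already has the full
  mass 1 of \<open>f n\<close>, so nothing is left for the zeros of \<open>f n\<close>.\<close>

lemma AE_eq_f:
  assumes [measurable]: "q \<in> borel_measurable (lborel_pow n)" and q0: "\<And>x. 0 \<le> q x"
    and q1: "(\<integral>\<^sup>+x. ennreal (q x) \<partial>lborel_pow n) = 1"
    and eq: "AE x in lborel_pow n. 0 < f n x \<longrightarrow> q x = f n x"
  shows "AE x in lborel_pow n. q x = f n x"
proof -
  let ?r = "\<lambda>x. ennreal (q x) * indicator {x. f n x = 0} x"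
  have "1 = (\<integral>\<^sup>+x. ennreal (f n x) + ?r x \<partial>lborel_pow n)"
    unfolding q1[symmetric]
    by (rule nn_integral_cong_AE) (use eq in eventually_elim, use f_nonneg in \<open>auto simp: indicator_def less_le\<close>)
  also have "\<dots> = 1 + (\<integral>\<^sup>+x. ?r x \<partial>lborel_pow n)"
    by (subst nn_integral_add) (simp_all add: nn_integral_f)
  finally have "1 + 0 = 1 + (\<integral>\<^sup>+x. ?r x \<partial>lborel_pow n)" by simp
  then have "(\<integral>\<^sup>+x. ?r x \<partial>lborel_pow n) = 0"
    unfolding ennreal_add_left_cancel by simp
  then have "AE x in lborel_pow n. ?r x = 0"
    by (subst (asm) nn_integral_0_iff_AE) measurable
  with eq show ?thesis
  proof eventually_elim
    case (elim x)
    then show ?case using f_nonneg[of n x] q0[of x] by (cases "f n x = 0") (auto simp: less_le)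
  qed
qed

text \<open>For \<open>m = p\<close> the two factors \<open>f p\<close> cancel wherever they are
  positive, which is almost surely along the process. Consequently the kernel always is the
  conditional law given exactly the \<open>p\<close> preceding values.\<close>

lemma AE_memory_density_eq_f: "AE x in lborel_pow (Suc p). memory_density p p x = f (Suc p) x"
proof (rule AE_eq_f)
  have [measurable]: "window 0 p \<in> lborel_pow (Suc p) \<rightarrow>\<^sub>M lborel_pow p"
    by (rule window_measurable) simp
  have "AE \<omega> in M. 0 < f p (window 0 p (block 0 (Suc p) \<omega>))"
    using f_block_pos[of p 0] by (simp add: window_block)
  then have "AE x in lborel_pow (Suc p). 0 < f (Suc p) x \<longrightarrow> 0 < f p (window 0 p x)"
    by (subst (asm) AE_block_iff) measurable
  with AE_space show "AE x in lborel_pow (Suc p). 0 < f (Suc p) x \<longrightarrow> memory_density p p x = f (Suc p) x"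
    by eventually_elim (auto simp: memory_density_def window_0)
qed (auto simp: memory_density_nonneg nn_integral_memory_density)

abbreviation past :: "nat \<Rightarrow> nat \<Rightarrow> 'a measure" where
  "past j m \<equiv> generated_by M X {j..<j + m}"

lemma space_past [simp]: "space (past j m) = space M"
  by (simp add: generated_by_def)

lemma block_measurable_past:
  assumes "j \<le> k" "k + n \<le> j + m"
  shows "block k n \<in> past j m \<rightarrow>\<^sub>M lborel_pow n"
proof -
  have gen: "(\<lambda>\<omega>. \<lambda>i\<in>{j..<j + m}. X i \<omega>) \<in> past j m \<rightarrow>\<^sub>M Pi\<^sub>M {j..<j + m} (\<lambda>_. borel)"
    unfolding generated_by_def by (rule measurable_vimage_algebra1) (auto simp: space_PiM)
  show ?thesis unfolding block_def[abs_def]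
  proof (rule measurable_restrict)
    fix i assume i: "i \<in> {..<n}"
    have "(\<lambda>\<omega>. (\<lambda>i\<in>{j..<j + m}. X i \<omega>) (k + i)) \<in> borel_measurable (past j m)"
      by (rule measurable_compose[OF gen measurable_component_singleton]) (use assms i in auto)
    then show "X (k + i) \<in> past j m \<rightarrow>\<^sub>M lborel" using assms i by simp
  qed
qed

lemma sets_past:
  assumes "A \<in> sets (past j m)"
  obtains A' where "A' \<in> sets (lborel_pow m)" "A = block j m -` A' \<inter> space M"
proof -
  \<comment> \<open>\<open>generated_by\<close> keeps the absolute times
    \<open>j, ..., j + m - 1\<close> as indices, whereas a block counts from 0; \<open>s\<close>
    translates between the two.\<close>
  define s where "s z = (\<lambda>i\<in>{j..<j + m}. z (i - j) :: real)" for z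
  have s: "s \<in> lborel_pow m \<rightarrow>\<^sub>M Pi\<^sub>M {j..<j + m} (\<lambda>_. borel)"
    unfolding s_def
  proof (rule measurable_restrict)
    fix i assume "i \<in> {j..<j + m}"
    then have "i - j \<in> {..<m}" by auto
    then have "(\<lambda>z. z (i - j)) \<in> lborel_pow m \<rightarrow>\<^sub>M lborel" by (rule measurable_component_singleton)
    then show "(\<lambda>z. z (i - j)) \<in> borel_measurable (lborel_pow m)" by (subst measurable_cong_sets[of _ _ borel lborel]) auto
  qed
  have sb: "(\<lambda>i\<in>{j..<j + m}. X i \<omega>) = s (block j m \<omega>)" for \<omega>
    by (auto simp: s_def block_def fun_eq_iff)
  have "(\<lambda>\<omega>. \<lambda>i\<in>{j..<j + m}. X i \<omega>) \<in> space M \<rightarrow> space (Pi\<^sub>M {j..<j + m} (\<lambda>_. borel))"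
    by (auto simp: space_PiM)
  from assms obtain C where C: "C \<in> sets (Pi\<^sub>M {j..<j + m} (\<lambda>_. borel))"
    "A = (\<lambda>\<omega>. \<lambda>i\<in>{j..<j + m}. X i \<omega>) -` C \<inter> space M"
    unfolding generated_by_def sets_vimage_algebra2[OF \<open>_ \<in> space M \<rightarrow> _\<close>] by blast
  show ?thesis
  proof
    show "s -` C \<inter> space (lborel_pow m) \<in> sets (lborel_pow m)" by (rule measurable_sets[OF s C(1)])
    show "A = block j m -` (s -` C \<inter> space (lborel_pow m)) \<inter> space M"
      using measurable_space[OF block_measurable, of _ j m] by (auto simp: C(2) sb)
  qed
qed

lemma subalgebra_past: "subalgebra M (past j m)"
  unfolding subalgebra_def
proof
  show "sets (past j m) \<subseteq> sets M"
  proof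
    fix A assume "A \<in> sets (past j m)"
    then obtain A' where "A' \<in> sets (lborel_pow m)" "A = block j m -` A' \<inter> space M" by (rule sets_past)
    then show "A \<in> sets M" by (simp add: measurable_sets[OF block_measurable])
  qed
qed simp

text \<open>The characterization of conditional expectation by integrals over events of the past,
  with these events written through the block and the integrals made nonnegative, so that they can
  be computed with densities.\<close>

lemma cond_prob_iff:
  assumes g: "g \<in> borel_measurable (past j m)" and bounds: "\<And>\<omega>. 0 \<le> g \<omega>" "\<And>\<omega>. g \<omega> \<le> 1"
    and [measurable]: "B \<in> sets borel"
  shows "(AE \<omega> in M. g \<omega> = real_cond_exp M (past j m) (indicator (X n -` B)) \<omega>) \<longleftrightarrow>
    (\<forall>A\<in>sets (lborel_pow m). (\<integral>\<^sup>+\<omega>. indicator A (block j m \<omega>) * ennreal (g \<omega>) \<partial>M) =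
      (\<integral>\<^sup>+\<omega>. indicator A (block j m \<omega>) * indicator B (X n \<omega>) \<partial>M))"
proof -
  interpret finite_measure_subalgebra M "past j m"
    by unfold_locales (rule subalgebra_past)
  have [measurable]: "g \<in> borel_measurable M" by (rule measurable_from_subalg[OF subalgebra_past g])
  let ?h = "indicator (X n -` B) :: 'a \<Rightarrow> real"
  have h_eq: "?h = (\<lambda>\<omega>. indicator B (X n \<omega>))" by (auto simp: indicator_def)
  have [measurable]: "?h \<in> borel_measurable M" unfolding h_eq by measurable
  have int_g: "integrable M g"
    by (rule integrable_const_bound[of _ 1]) (use bounds in auto)
  have int_h: "integrable M ?h"
    by (rule integrable_const_bound[of _ 1]) (auto simp: indicator_def)
  have to_nn: "ennreal (\<integral>\<omega>\<in>block j m -` A \<inter> space M. u \<omega> \<partial>M) =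
      (\<integral>\<^sup>+\<omega>. indicator A (block j m \<omega>) * ennreal (u \<omega>) \<partial>M)"
    if [measurable]: "A \<in> sets (lborel_pow m)" and u: "integrable M u" "\<And>\<omega>. 0 \<le> u \<omega>" for A u
  proof -
    have "(\<integral>\<omega>\<in>block j m -` A \<inter> space M. u \<omega> \<partial>M) = (\<integral>\<omega>. indicator A (block j m \<omega>) * u \<omega> \<partial>M)"
      unfolding set_lebesgue_integral_def by (rule Bochner_Integration.integral_cong) (auto simp: indicator_def)
    also have "ennreal \<dots> = (\<integral>\<^sup>+\<omega>. ennreal (indicator A (block j m \<omega>) * u \<omega>) \<partial>M)"
    proof (rule nn_integral_eq_integral[symmetric])
      show "integrable M (\<lambda>\<omega>. indicator A (block j m \<omega>) * u \<omega>)"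
        by (rule Bochner_Integration.integrable_bound[OF u(1)]) (use u in \<open>auto simp: indicator_def\<close>)
    qed (use u in auto)
    also have "\<dots> = (\<integral>\<^sup>+\<omega>. indicator A (block j m \<omega>) * ennreal (u \<omega>) \<partial>M)"
      by (intro nn_integral_cong) (auto simp: indicator_def)
    finally show ?thesis .
  qed
  have h_nn: "ennreal (?h \<omega>) = indicator B (X n \<omega>)" for \<omega> by (auto simp: indicator_def)
  have nn_iff: "(\<integral>\<omega>\<in>block j m -` A \<inter> space M. g \<omega> \<partial>M) = (\<integral>\<omega>\<in>block j m -` A \<inter> space M. ?h \<omega> \<partial>M) \<longleftrightarrow>
    (\<integral>\<^sup>+\<omega>. indicator A (block j m \<omega>) * ennreal (g \<omega>) \<partial>M) =
      (\<integral>\<^sup>+\<omega>. indicator A (block j m \<omega>) * indicator B (X n \<omega>) \<partial>M)"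
    if A: "A \<in> sets (lborel_pow m)" for A
  proof -
    have nonneg: "0 \<le> (\<integral>\<omega>\<in>block j m -` A \<inter> space M. u \<omega> \<partial>M)" if "\<And>\<omega>. 0 \<le> u \<omega>" for u :: "'a \<Rightarrow> real"
      unfolding set_lebesgue_integral_def using that by (intro integral_nonneg_AE AE_I2) simp
    have "ennreal (\<integral>\<omega>\<in>block j m -` A \<inter> space M. ?h \<omega> \<partial>M) =
        (\<integral>\<^sup>+\<omega>. indicator A (block j m \<omega>) * indicator B (X n \<omega>) \<partial>M)"
      unfolding h_nn[symmetric] by (rule to_nn[OF A int_h]) (rule indicator_pos_le)
    then show ?thesis
      unfolding to_nn[OF A int_g bounds(1), symmetric]
      using ennreal_inj[OF nonneg[of g] nonneg[of ?h]] bounds by fastforce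
  qed
  show ?thesis
  proof (intro iffI ballI)
    fix A assume AE: "AE \<omega> in M. g \<omega> = real_cond_exp M (past j m) ?h \<omega>" and A: "A \<in> sets (lborel_pow m)"
    have A': "block j m -` A \<inter> space M \<in> sets (past j m)"
      using measurable_sets[OF block_measurable_past[of j j m m] A] by simp
    then have [measurable]: "block j m -` A \<inter> space M \<in> sets M"
      using subalgebra_past by (auto simp: subalgebra_def)
    have "(\<integral>\<omega>\<in>block j m -` A \<inter> space M. g \<omega> \<partial>M) = (\<integral>\<omega>\<in>block j m -` A \<inter> space M. real_cond_exp M (past j m) ?h \<omega> \<partial>M)"
      by (rule set_lebesgue_integral_cong_AE) (use AE in auto)
    then show "(\<integral>\<^sup>+\<omega>. indicator A (block j m \<omega>) * ennreal (g \<omega>) \<partial>M) =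
      (\<integral>\<^sup>+\<omega>. indicator A (block j m \<omega>) * indicator B (X n \<omega>) \<partial>M)"
      using real_cond_exp_intA[OF int_h A'] by (subst nn_iff[OF A, symmetric]) simp
  next
    assume eq: "\<forall>A\<in>sets (lborel_pow m). (\<integral>\<^sup>+\<omega>. indicator A (block j m \<omega>) * ennreal (g \<omega>) \<partial>M) =
      (\<integral>\<^sup>+\<omega>. indicator A (block j m \<omega>) * indicator B (X n \<omega>) \<partial>M)"
    have "AE \<omega> in M. real_cond_exp M (past j m) ?h \<omega> = g \<omega>"
    proof (rule real_cond_exp_charact[OF _ int_h int_g g])
      fix A assume "A \<in> sets (past j m)"
      then obtain A' where A': "A' \<in> sets (lborel_pow m)" "A = block j m -` A' \<inter> space M" by (rule sets_past)
      show "(\<integral>\<omega>\<in>A. ?h \<omega> \<partial>M) = (\<integral>\<omega>\<in>A. g \<omega> \<partial>M)"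
        unfolding A'(2) by (rule nn_iff[OF A'(1), THEN iffD2, OF bspec[OF eq A'(1)], symmetric])
    qed
    then show "AE \<omega> in M. g \<omega> = real_cond_exp M (past j m) ?h \<omega>" by eventually_elim simp
  qed
qed

text \<open>Finite-dimensional rectangles determine a measure, so the conditional probabilities given by
  the kernel are the right ones precisely when the two joint densities agree.\<close>

lemma kernel_cond_prob_iff:
  assumes pm: "p \<le> m"
  shows "(\<forall>B\<in>sets borel. AE \<omega> in M. measure (kernel p (block (j + (m - p)) p \<omega>)) B =
      real_cond_exp M (past j m) (indicator (X (j + m) -` B)) \<omega>) \<longleftrightarrow>
    (AE x in lborel_pow (Suc m). memory_density p m x = f (Suc m) x)"
    (is "?cond \<longleftrightarrow> ?dens")
proof -
  let ?K = "\<lambda>\<omega>. kernel p (block (j + (m - p)) p \<omega>)"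
  let ?rect = "\<lambda>A B x. indicator A (window 0 m x) * indicator B (x m) :: ennreal"
  let ?q = "memory_density p m"
  have [measurable]: "window 0 m \<in> lborel_pow (Suc m) \<rightarrow>\<^sub>M lborel_pow m"
    by (rule window_measurable) simp
  note [measurable] = memory_density_measurable[OF pm]
  have K_space: "?K \<omega> \<in> space (prob_algebra borel)" if "\<omega> \<in> space M" for \<omega>
    using that by (intro measurable_space[OF kernel_measurable] measurable_space[OF block_measurable])
  have K_past: "?K \<in> past j m \<rightarrow>\<^sub>M prob_algebra borel"
    by (rule measurable_compose[OF block_measurable_past kernel_measurable]) (use pm in auto)
  have measure_K: "(AE \<omega> in M. measure (?K \<omega>) B = real_cond_exp M (past j m) (indicator (X (j + m) -` B)) \<omega>) \<longleftrightarrow>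
      (\<forall>A\<in>sets (lborel_pow m). (\<integral>\<^sup>+x. ennreal (?q x) * ?rect A B x \<partial>lborel_pow (Suc m)) =
        (\<integral>\<^sup>+x. ennreal (f (Suc m) x) * ?rect A B x \<partial>lborel_pow (Suc m)))"
    if B [measurable]: "B \<in> sets borel" for B
  proof -
    \<comment> \<open>Cut off outside \<open>space M\<close>, because the bounds in
      \<open>cond_prob_iff\<close> range over all points, while \<open>K_space\<close> speaks about
      \<open>space M\<close>.\<close>
    define g where "g \<omega> = (if \<omega> \<in> space M then measure (?K \<omega>) B else 0)" for \<omega>
    have g: "g \<in> borel_measurable (past j m)"
      by (subst measurable_cong[of _ _ "\<lambda>\<omega>. measure (?K \<omega>) B"])
        (use measurable_compose[OF K_past measurable_measure_prob_algebra[OF B]] in \<open>auto simp: g_def\<close>)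
    have g01: "0 \<le> g \<omega>" "g \<omega> \<le> 1" for \<omega>
      using K_space[of \<omega>] by (auto simp: g_def space_prob_algebra prob_space.prob_le_1)
    have "(AE \<omega> in M. measure (?K \<omega>) B = real_cond_exp M (past j m) (indicator (X (j + m) -` B)) \<omega>) \<longleftrightarrow>
       (AE \<omega> in M. g \<omega> = real_cond_exp M (past j m) (indicator (X (j + m) -` B)) \<omega>)"
      by (rule AE_cong) (simp add: g_def)
    also have "\<dots> \<longleftrightarrow> (\<forall>A\<in>sets (lborel_pow m). (\<integral>\<^sup>+\<omega>. indicator A (block j m \<omega>) * ennreal (g \<omega>) \<partial>M) =
      (\<integral>\<^sup>+\<omega>. indicator A (block j m \<omega>) * indicator B (X (j + m) \<omega>) \<partial>M))"
      by (rule cond_prob_iff[OF g g01 B])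
    also have "\<dots> \<longleftrightarrow> (\<forall>A\<in>sets (lborel_pow m). (\<integral>\<^sup>+x. ennreal (?q x) * ?rect A B x \<partial>lborel_pow (Suc m)) =
        (\<integral>\<^sup>+x. ennreal (f (Suc m) x) * ?rect A B x \<partial>lborel_pow (Suc m)))"
    proof (intro ball_cong refl arg_cong2[where f = "(=)"])
      fix A assume A [measurable]: "A \<in> sets (lborel_pow m)"
      show "(\<integral>\<^sup>+\<omega>. indicator A (block j m \<omega>) * ennreal (g \<omega>) \<partial>M) =
          (\<integral>\<^sup>+x. ennreal (?q x) * ?rect A B x \<partial>lborel_pow (Suc m))"
        unfolding nn_integral_kernel[OF pm A B, of j, symmetric]
      proof (rule nn_integral_cong)
        fix \<omega> assume "\<omega> \<in> space M"
        with K_space[of \<omega>] interpret K: prob_space "?K \<omega>" by (simp add: space_prob_algebra)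
        show "indicator A (block j m \<omega>) * ennreal (g \<omega>) = indicator A (block j m \<omega>) * emeasure (?K \<omega>) B"
          using \<open>\<omega> \<in> space M\<close> by (simp add: g_def K.emeasure_eq_measure)
      qed
      have "(\<integral>\<^sup>+x. ennreal (f (Suc m) x) * ?rect A B x \<partial>lborel_pow (Suc m)) = (\<integral>\<^sup>+\<omega>. ?rect A B (block j (Suc m) \<omega>) \<partial>M)"
        by (rule nn_integral_block[symmetric]) measurable
      also have "\<dots> = (\<integral>\<^sup>+\<omega>. indicator A (block j m \<omega>) * indicator B (X (j + m) \<omega>) \<partial>M)"
        by (simp add: window_block) (simp add: block_def)
      finally show "(\<integral>\<^sup>+\<omega>. indicator A (block j m \<omega>) * indicator B (X (j + m) \<omega>) \<partial>M) =
         (\<integral>\<^sup>+x. ennreal (f (Suc m) x) * ?rect A B x \<partial>lborel_pow (Suc m))" by simp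
    qed
    finally show ?thesis .
  qed
  show ?thesis
  proof
    assume ?dens
    have "(\<integral>\<^sup>+x. ennreal (?q x) * ?rect A B x \<partial>lborel_pow (Suc m)) =
        (\<integral>\<^sup>+x. ennreal (f (Suc m) x) * ?rect A B x \<partial>lborel_pow (Suc m))" for A B
      by (rule nn_integral_cong_AE) (use \<open>?dens\<close> in eventually_elim, simp)
    then show ?cond using measure_K by simp
  next
    assume ?cond
    then have rect: "(\<integral>\<^sup>+x. ennreal (?q x) * ?rect A B x \<partial>lborel_pow (Suc m)) =
        (\<integral>\<^sup>+x. ennreal (f (Suc m) x) * ?rect A B x \<partial>lborel_pow (Suc m))"
      if "A \<in> sets (lborel_pow m)" "B \<in> sets borel" for A B
      using measure_K that by blast
    interpret L: sigma_finite_measure "lborel_pow (Suc m)" by (rule sigma_finite_lborel_pow)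
    have "density (lborel_pow (Suc m)) (\<lambda>x. ennreal (?q x)) = density (lborel_pow (Suc m)) (\<lambda>x. ennreal (f (Suc m) x))"
    \<comment> \<open>The exhausting sequence of sets is constantly the whole space, whose mass is
      finite.\<close>
    proof (rule measure_eqI_PiM_finite[where I = "{..<Suc m}" and M = "\<lambda>_. lborel" and A = "\<lambda>_. space (lborel_pow (Suc m))"])
      fix E :: "nat \<Rightarrow> real set" assume E: "\<And>i. i \<in> {..<Suc m} \<Longrightarrow> E i \<in> sets lborel"
      have [measurable]: "Pi\<^sub>E {..<Suc m} E \<in> sets (lborel_pow (Suc m))" "Pi\<^sub>E {..<m} E \<in> sets (lborel_pow m)"
        using E by (auto intro!: sets_PiM_I_finite)
      \<comment> \<open>A box is one condition on the first \<open>m\<close> coordinates and one on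
        the last, hence among the sets tested by \<open>rect\<close>.\<close>
      have "indicator (Pi\<^sub>E {..<Suc m} E) x = ?rect (Pi\<^sub>E {..<m} E) (E m) x" if "x \<in> space (lborel_pow (Suc m))" for x
      proof -
        have "x \<in> Pi\<^sub>E {..<Suc m} E \<longleftrightarrow> (\<forall>i<Suc m. x i \<in> E i)"
          using that by (auto simp: space_PiM PiE_iff)
        moreover have "window 0 m x \<in> Pi\<^sub>E {..<m} E \<longleftrightarrow> (\<forall>i<m. x i \<in> E i)"
          by (auto simp: window_def PiE_iff)
        ultimately show ?thesis by (auto simp: indicator_def All_less_Suc)
      qed
      then show "emeasure (density (lborel_pow (Suc m)) (\<lambda>x. ennreal (?q x))) (Pi\<^sub>E {..<Suc m} E) =
          emeasure (density (lborel_pow (Suc m)) (\<lambda>x. ennreal (f (Suc m) x))) (Pi\<^sub>E {..<Suc m} E)"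
        using rect[of "Pi\<^sub>E {..<m} E" "E m"] E by (simp add: emeasure_density cong: nn_integral_cong)
    next
      show "range (\<lambda>_. space (lborel_pow (Suc m))) \<subseteq> prod_algebra {..<Suc m} (\<lambda>_. lborel)"
        by (auto simp: space_PiM intro!: prod_algebraI_finite)
    next
      show "emeasure (density (lborel_pow (Suc m)) (\<lambda>x. ennreal (?q x))) (space (lborel_pow (Suc m))) \<noteq> \<infinity>"
        by (simp add: emeasure_density nn_integral_memory_density[OF pm] cong: nn_integral_cong)
    qed auto
    then have "AE x in lborel_pow (Suc m). ennreal (?q x) = ennreal (f (Suc m) x)"
      by (subst (asm) L.density_unique_iff) measurable
    then show ?dens
      by eventually_elim (simp add: memory_density_nonneg f_nonneg)
  qed
qed

lemma is_cond_law_kernel_iff: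
  assumes "p \<le> m"
  shows "is_cond_law M (past j m) (X (j + m)) (\<lambda>\<omega>. kernel p (block (j + (m - p)) p \<omega>)) \<longleftrightarrow>
    (AE x in lborel_pow (Suc m). memory_density p m x = f (Suc m) x)"
proof -
  have "(\<lambda>\<omega>. kernel p (block (j + (m - p)) p \<omega>)) \<in> past j m \<rightarrow>\<^sub>M prob_algebra borel"
    by (rule measurable_compose[OF block_measurable_past kernel_measurable]) (use assms in auto)
  then show ?thesis
    using kernel_cond_prob_iff[OF assms, of j] unfolding is_cond_law_def by blast
qed

text \<open>The kernel is always the conditional law given the last \<open>p\<close> values. Memory
  \<open>p\<close> therefore means that it is the conditional law given the whole past too.\<close>

lemma has_memory_iff:
  "has_memory M p X \<longleftrightarrow> (\<forall>n\<ge>p. AE x in lborel_pow (Suc n). memory_density p n x = f (Suc n) x)"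
  unfolding has_memory_def
proof (intro all_cong)
  fix n assume pn: "p \<le> n"
  let ?L = "\<lambda>\<omega>. kernel p (block (n - p) p \<omega>)"
  \<comment> \<open>The case \<open>m = p\<close> with the past starting at
    \<open>j = n - p\<close>.\<close>
  have L: "is_cond_law M (generated_by M X {n - p..<n}) (X n) ?L"
    using is_cond_law_kernel_iff[of p p "n - p"] AE_memory_density_eq_f[of p] pn by simp
  have all: "is_cond_law M (generated_by M X {0..<n}) (X n) ?L \<longleftrightarrow>
      (AE x in lborel_pow (Suc n). memory_density p n x = f (Suc n) x)"
    using is_cond_law_kernel_iff[OF pn, of 0] by simp
  show "(\<exists>K L. is_cond_law M (generated_by M X {0..<n}) (X n) K \<and>
      is_cond_law M (generated_by M X {n - p..<n}) (X n) L \<and> (AE \<omega> in M. K \<omega> = L \<omega>)) \<longleftrightarrow>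
    (AE x in lborel_pow (Suc n). memory_density p n x = f (Suc n) x)"
  proof
    assume "\<exists>K L. is_cond_law M (generated_by M X {0..<n}) (X n) K \<and>
      is_cond_law M (generated_by M X {n - p..<n}) (X n) L \<and> (AE \<omega> in M. K \<omega> = L \<omega>)"
    then obtain K K' where K: "is_cond_law M (generated_by M X {0..<n}) (X n) K"
      and K': "is_cond_law M (generated_by M X {n - p..<n}) (X n) K'" and eq: "AE \<omega> in M. K \<omega> = K' \<omega>"
      by blast
    \<comment> \<open>For each fixed \<open>B\<close>, the chain runs from \<open>?L\<close> through
      the conditional probability given the last \<open>p\<close> values to \<open>K'\<close>, then
      to \<open>K\<close>, and then to the conditional probability given the whole past.\<close>
    have "AE \<omega> in M. measure (?L \<omega>) B = real_cond_exp M (generated_by M X {0..<n}) (indicator (X n -` B)) \<omega>"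
      if B: "B \<in> sets borel" for B
    proof -
      have "AE \<omega> in M. measure (?L \<omega>) B = real_cond_exp M (generated_by M X {n - p..<n}) (indicator (X n -` B)) \<omega>"
        "AE \<omega> in M. measure (K' \<omega>) B = real_cond_exp M (generated_by M X {n - p..<n}) (indicator (X n -` B)) \<omega>"
        "AE \<omega> in M. measure (K \<omega>) B = real_cond_exp M (generated_by M X {0..<n}) (indicator (X n -` B)) \<omega>"
        by (rule L[unfolded is_cond_law_def, THEN conjunct2, THEN bspec, OF B]
            K'[unfolded is_cond_law_def, THEN conjunct2, THEN bspec, OF B]
            K[unfolded is_cond_law_def, THEN conjunct2, THEN bspec, OF B])+
      with eq show ?thesis by eventually_elim simp
    qed
    then show "AE x in lborel_pow (Suc n). memory_density p n x = f (Suc n) x"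
      using kernel_cond_prob_iff[OF pn, of 0] by simp
  next
    assume "AE x in lborel_pow (Suc n). memory_density p n x = f (Suc n) x"
    with all have "is_cond_law M (generated_by M X {0..<n}) (X n) ?L" by blast
    with L show "\<exists>K L. is_cond_law M (generated_by M X {0..<n}) (X n) K \<and>
      is_cond_law M (generated_by M X {n - p..<n}) (X n) L \<and> (AE \<omega> in M. K \<omega> = L \<omega>)"
      by (intro exI[of _ ?L] conjI AE_I2 refl)
  qed
qed

subsection \<open>Block entropies\<close>

text \<open>Entropies become expectations on \<open>M\<close>, where the logarithms for blocks of
  different lengths and positions can be added. The argument of \<open>ln\<close> is almost surely
  positive by \<open>f_block_pos\<close>.\<close>

definition log_density :: "nat \<Rightarrow> nat \<Rightarrow> 'a \<Rightarrow> real" where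
  "log_density k n \<omega> = ln (f n (block k n \<omega>))"

lemma log_density_measurable [measurable]: "log_density k n \<in> borel_measurable M"
  unfolding log_density_def by measurable

definition block_entropy :: "nat \<Rightarrow> ereal" where
  "block_entropy n = extended_integral (lborel_pow n) (\<lambda>x. psi (f n x))"

text \<open>The factorization of \<open>psi\<close> holds at zeros of \<open>f n\<close> as well,
  and the two parts are transferred to \<open>M\<close> separately, so infinite values are
  covered.\<close>

lemma block_entropy_eq:
  "block_entropy n = enn2ereal (\<integral>\<^sup>+\<omega>. ennreal (- log_density 0 n \<omega>) \<partial>M) - enn2ereal (\<integral>\<^sup>+\<omega>. ennreal (log_density 0 n \<omega>) \<partial>M)"
proof -
  have *: "ennreal (psi (f n x)) = ennreal (f n x) * ennreal (- ln (f n x))"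
    "ennreal (- psi (f n x)) = ennreal (f n x) * ennreal (ln (f n x))" for x
    using f_nonneg by (simp_all add: psi_def ennreal_mult'[symmetric])
  show ?thesis
    unfolding block_entropy_def extended_integral_def log_density_def *
    by (subst (1 2) nn_integral_block[where k = 0, symmetric]) simp_all
qed

lemma log_density_shift:
  shows "integrable M (log_density k n) \<longleftrightarrow> integrable M (log_density 0 n)"
    and "(\<integral>\<omega>. log_density k n \<omega> \<partial>M) = (\<integral>\<omega>. log_density 0 n \<omega> \<partial>M)"
proof -
  have "integrable M (log_density j n) \<longleftrightarrow> integrable (density (lborel_pow n) (\<lambda>x. ennreal (f n x))) (\<lambda>x. ln (f n x))" for j
    unfolding distr_eq_density[of n j, symmetric] log_density_def[abs_def]
    by (rule integrable_distr_eq[symmetric]) measurable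
  then show "integrable M (log_density k n) \<longleftrightarrow> integrable M (log_density 0 n)" by simp
  have "(\<integral>\<omega>. log_density j n \<omega> \<partial>M) = (\<integral>x. ln (f n x) \<partial>density (lborel_pow n) (\<lambda>x. ennreal (f n x)))" for j
    unfolding distr_eq_density[of n j, symmetric] log_density_def[abs_def]
    by (rule integral_distr[symmetric]) measurable
  then show "(\<integral>\<omega>. log_density k n \<omega> \<partial>M) = (\<integral>\<omega>. log_density 0 n \<omega> \<partial>M)" by simp
qed

text \<open>Multiplying the ratio by \<open>f n\<close> gives back \<open>q\<close> where
  \<open>f n\<close> is positive and 0 elsewhere, as division by 0 is 0. Mass of \<open>q\<close> on
  the zeros of \<open>f n\<close> is lost, hence only an inequality.\<close>

lemma nn_integral_density_ratio:
  assumes [measurable]: "q \<in> borel_measurable (lborel_pow n)" and q0: "\<And>x. 0 \<le> q x"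
    and q1: "(\<integral>\<^sup>+x. ennreal (q x) \<partial>lborel_pow n) = 1"
  shows "(\<integral>\<^sup>+\<omega>. ennreal (q (block k n \<omega>) / f n (block k n \<omega>)) \<partial>M) \<le> 1"
proof -
  have "(\<integral>\<^sup>+\<omega>. ennreal (q (block k n \<omega>) / f n (block k n \<omega>)) \<partial>M) =
      (\<integral>\<^sup>+x. ennreal (f n x) * ennreal (q x / f n x) \<partial>lborel_pow n)"
    by (rule nn_integral_block) measurable
  also have "\<dots> \<le> (\<integral>\<^sup>+x. ennreal (q x) \<partial>lborel_pow n)"
    using f_nonneg q0 by (intro nn_integral_mono) (simp add: ennreal_mult[symmetric])
  finally show ?thesis using q1 by simp
qed

text \<open>A one-sided bound for any reference density \<open>q\<close>. It is used with a Gaussian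
  product and with \<open>f n\<close> times a Gaussian in the last coordinate.\<close>

lemma nn_integral_ln_density_ratio:
  assumes [measurable]: "q \<in> borel_measurable (lborel_pow n)" and q0: "\<And>x. 0 \<le> q x"
    and q1: "(\<integral>\<^sup>+x. ennreal (q x) \<partial>lborel_pow n) = 1"
    and pos: "AE \<omega> in M. 0 < q (block k n \<omega>)"
  shows "(\<integral>\<^sup>+\<omega>. ennreal (ln (q (block k n \<omega>)) - log_density k n \<omega>) \<partial>M) < \<infinity>"
proof -
  let ?R = "\<lambda>\<omega>. q (block k n \<omega>) / f n (block k n \<omega>)"
  have "(\<integral>\<^sup>+\<omega>. ennreal (ln (q (block k n \<omega>)) - log_density k n \<omega>) \<partial>M) = (\<integral>\<^sup>+\<omega>. ennreal (ln (?R \<omega>)) \<partial>M)"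
    by (rule nn_integral_cong_AE) (use pos f_block_pos[of n k] in eventually_elim, simp add: log_density_def ln_div)
  also have "\<dots> < \<infinity>"
  proof (rule nn_integral_ln_finite)
    show "AE \<omega> in M. 0 < ?R \<omega>" using pos f_block_pos[of n k] by eventually_elim simp
  qed (use nn_integral_density_ratio[OF assms(1) q0 q1] in simp_all)
  finally show ?thesis .
qed

lemma integrable_ln_std_normal: "integrable M (\<lambda>\<omega>. ln (std_normal_density (X i \<omega>)))"
  unfolding ln_std_normal_density using square_integrable by simp

text \<open>Comparison with the standard Gaussian: square integrability bounds the entropy from above.\<close>

lemma nn_integral_neg_log_density: "(\<integral>\<^sup>+\<omega>. ennreal (- log_density 0 n \<omega>) \<partial>M) < \<infinity>"
proof (rule nn_integral_le_add_finite)
  let ?q = "\<lambda>x. \<Prod>i<n. std_normal_density (x i)"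
  let ?g = "\<lambda>\<omega>. \<Sum>i<n. ln (std_normal_density (X i \<omega>))"
  have pos: "0 < ?q x" for x by (intro prod_pos) (simp add: normal_density_pos)
  have ln_q: "ln (?q (block 0 n \<omega>)) = ?g \<omega>" for \<omega>
    by (subst ln_prod) (auto simp: block_def less_imp_neq[OF normal_density_pos, THEN not_sym])
  have "(\<integral>\<^sup>+\<omega>. ennreal (ln (?q (block 0 n \<omega>)) - log_density 0 n \<omega>) \<partial>M) < \<infinity>"
  proof (rule nn_integral_ln_density_ratio)
    have "(\<integral>\<^sup>+x. ennreal (?q x) \<partial>lborel_pow n) = (\<integral>\<^sup>+x. (\<Prod>i<n. ennreal (std_normal_density (x i))) \<partial>lborel_pow n)"
      by (simp add: prod_ennreal)
    also have "\<dots> = 1"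
      by (subst lborel_product.product_nn_integral_prod) (simp_all add: nn_integral_std_normal)
    finally show "(\<integral>\<^sup>+x. ennreal (?q x) \<partial>lborel_pow n) = 1" .
  qed (use pos in \<open>auto intro: less_imp_le\<close>)
  then show "(\<integral>\<^sup>+\<omega>. ennreal (?g \<omega> - log_density 0 n \<omega>) \<partial>M) < \<infinity>" unfolding ln_q .
  show "integrable M (\<lambda>\<omega>. - ?g \<omega>)" using integrable_ln_std_normal by simp
qed auto

text \<open>Compare \<open>f (Suc n)\<close> with the density that appends an independent Gaussian
  to \<open>f n\<close>. This bounds the positive part of \<open>log_density 0 n\<close> up to
  integrable terms; the negative part is handled by
  \<open>nn_integral_neg_log_density\<close>.\<close>

lemma integrable_log_density_Suc:
  assumes "integrable M (log_density 0 (Suc n))"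
  shows "integrable M (log_density 0 n)"
proof -
  let ?q = "\<lambda>x. f n (window 0 n x) * std_normal_density (x n)"
  have [measurable]: "window 0 n \<in> lborel_pow (Suc n) \<rightarrow>\<^sub>M lborel_pow n"
    by (rule window_measurable) simp
  have q_block: "?q (block 0 (Suc n) \<omega>) = f n (block 0 n \<omega>) * std_normal_density (X n \<omega>)" for \<omega>
    by (simp add: window_block) (simp add: block_def)
  have "(\<integral>\<^sup>+\<omega>. ennreal (ln (?q (block 0 (Suc n) \<omega>)) - log_density 0 (Suc n) \<omega>) \<partial>M) < \<infinity>"
  proof (rule nn_integral_ln_density_ratio)
    have "(\<integral>\<^sup>+x. ennreal (?q x) \<partial>lborel_pow (Suc n)) =
        (\<integral>\<^sup>+x. (\<integral>\<^sup>+y. ennreal (?q (x(n := y))) \<partial>lborel) \<partial>lborel_pow n)"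
      by (rule nn_integral_lborel_pow_Suc) measurable
    also have "\<dots> = (\<integral>\<^sup>+x. ennreal (f n x) \<partial>lborel_pow n)"
      by (intro nn_integral_cong)
        (simp add: window_fun_upd_last window_0 ennreal_mult f_nonneg nn_integral_cmult nn_integral_std_normal)
    finally show "(\<integral>\<^sup>+x. ennreal (?q x) \<partial>lborel_pow (Suc n)) = 1" by (simp add: nn_integral_f)
    show "AE \<omega> in M. 0 < ?q (block 0 (Suc n) \<omega>)"
      unfolding q_block using f_block_pos[of n 0] by eventually_elim (simp add: normal_density_pos)
  qed (use f_nonneg in simp_all)
  also have "(\<integral>\<^sup>+\<omega>. ennreal (ln (?q (block 0 (Suc n) \<omega>)) - log_density 0 (Suc n) \<omega>) \<partial>M) =
      (\<integral>\<^sup>+\<omega>. ennreal (log_density 0 n \<omega> + ln (std_normal_density (X n \<omega>)) - log_density 0 (Suc n) \<omega>) \<partial>M)"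
    unfolding q_block
    by (rule nn_integral_cong_AE) (use f_block_pos[of n 0] in eventually_elim, simp add: log_density_def ln_mult
        less_imp_neq[OF normal_density_pos, THEN not_sym])
  finally have fin: "(\<integral>\<^sup>+\<omega>. ennreal (log_density 0 n \<omega> + ln (std_normal_density (X n \<omega>)) - log_density 0 (Suc n) \<omega>) \<partial>M) < \<infinity>" .
  have "(\<integral>\<^sup>+\<omega>. ennreal (log_density 0 n \<omega>) \<partial>M) < \<infinity>"
    by (rule nn_integral_le_add_finite[OF _ _ _ _ fin,
        where b = "\<lambda>\<omega>. log_density 0 (Suc n) \<omega> - ln (std_normal_density (X n \<omega>))"])
      (use assms integrable_ln_std_normal in auto)
  with nn_integral_neg_log_density[of n] show ?thesis
    by (simp add: real_integrable_def less_top)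
qed

lemma block_entropy_eq_integral:
  assumes "integrable M (log_density 0 n)"
  shows "block_entropy n = ereal (- (\<integral>\<omega>. log_density 0 n \<omega> \<partial>M))"
proof -
  obtain a b where "0 \<le> a" "0 \<le> b" "(\<integral>\<^sup>+\<omega>. ennreal (log_density 0 n \<omega>) \<partial>M) = ennreal a"
    "(\<integral>\<^sup>+\<omega>. ennreal (- log_density 0 n \<omega>) \<partial>M) = ennreal b"
    using assms unfolding real_integrable_def by (metis ennreal_cases infinity_ennreal_def)
  then show ?thesis
    using real_lebesgue_integral_def[OF assms] by (simp add: block_entropy_eq enn2ereal_ennreal)
qed

text \<open>The positive part of the entropy is finite, so integrability can fail only through the
  part that is subtracted.\<close>

lemma block_entropy_eq_MInf:
  assumes "\<not> integrable M (log_density 0 n)"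
  shows "block_entropy n = - \<infinity>"
proof -
  obtain b where "0 \<le> b" "(\<integral>\<^sup>+\<omega>. ennreal (- log_density 0 n \<omega>) \<partial>M) = ennreal b"
    using nn_integral_neg_log_density[of n] by (metis ennreal_cases infinity_ennreal_def less_irrefl)
  moreover from this have "(\<integral>\<^sup>+\<omega>. ennreal (log_density 0 n \<omega>) \<partial>M) = \<infinity>"
    using assms by (auto simp: real_integrable_def)
  ultimately show ?thesis by (simp add: block_entropy_eq enn2ereal_ennreal)
qed

text \<open>Failure of integrability passes to all longer blocks by
  \<open>integrable_log_density_Suc\<close>; their entropies would all be minus infinity, and so
  would the rate.\<close>

lemma integrable_log_density:
  assumes "\<bar>lim (\<lambda>n. block_entropy n / ereal (real n))\<bar> \<noteq> \<infinity>"
  shows "integrable M (log_density 0 n)"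
proof (rule ccontr)
  assume not: "\<not> integrable M (log_density 0 n)"
  have MInf: "block_entropy m = - \<infinity>" if "n \<le> m" for m
  proof (rule block_entropy_eq_MInf)
    show "\<not> integrable M (log_density 0 m)"
      using that by (induction m rule: dec_induct) (use not integrable_log_density_Suc in auto)
  qed
  have "(\<lambda>n. block_entropy n / ereal (real n)) \<longlonglongrightarrow> - \<infinity>"
  proof (rule tendsto_eventually)
    show "\<forall>\<^sub>F m in sequentially. block_entropy m / ereal (real m) = - \<infinity>"
      using eventually_ge_at_top[of n] eventually_gt_at_top[of 0]
      by eventually_elim (simp add: MInf)
  qed
  then have "lim (\<lambda>n. block_entropy n / ereal (real n)) = - \<infinity>" by (rule limI)
  with assms show False by simp
qed

text \<open>The expectation of \<open>ln R\<close>, with \<open>R\<close> the quotient of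
  \<open>memory_density p m\<close> by \<open>f (Suc m)\<close> along the process, is the difference
  of the two increments. The Gibbs inequality gives its sign and the equality case.\<close>

lemma block_entropy_increment:
  assumes pm: "p \<le> m" and int: "\<And>n. integrable M (log_density 0 n)"
  defines "h \<equiv> \<lambda>n. - (\<integral>\<omega>. log_density 0 n \<omega> \<partial>M)"
  shows "h (Suc m) - h m \<le> h (Suc p) - h p"
    and "h (Suc m) - h m = h (Suc p) - h p \<longleftrightarrow> (AE x in lborel_pow (Suc m). memory_density p m x = f (Suc m) x)"
proof -
  let ?q = "memory_density p m"
  define R where "R \<omega> = ?q (block 0 (Suc m) \<omega>) / f (Suc m) (block 0 (Suc m) \<omega>)" for \<omega>
  note [measurable] = memory_density_measurable[OF pm]
  have [measurable]: "R \<in> borel_measurable M" unfolding R_def by measurable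
  have q_block: "?q (block 0 (Suc m) \<omega>) =
      f m (block 0 m \<omega>) * (f (Suc p) (block (m - p) (Suc p) \<omega>) / f p (block (m - p) p \<omega>))" for \<omega>
    using pm by (simp add: memory_density_def window_block)
  note pos = f_block_pos[of "Suc m" 0] f_block_pos[of m 0] f_block_pos[of "Suc p" "m - p"] f_block_pos[of p "m - p"]
  have R_pos: "AE \<omega> in M. 0 < R \<omega>"
    using pos by eventually_elim (simp add: R_def q_block)
  have R_le: "(\<integral>\<^sup>+\<omega>. ennreal (R \<omega>) \<partial>M) \<le> 1"
    unfolding R_def by (rule nn_integral_density_ratio) (auto simp: memory_density_nonneg nn_integral_memory_density[OF pm])
  \<comment> \<open>The logarithm of \<open>R\<close> as a sum over four blocks. In expectation,
    stationarity moves the two that start at \<open>m - p\<close> to time 0.\<close>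
  let ?S = "\<lambda>\<omega>. log_density 0 m \<omega> + (log_density (m - p) (Suc p) \<omega> - log_density (m - p) p \<omega>) - log_density 0 (Suc m) \<omega>"
  have ln_R: "AE \<omega> in M. ln (R \<omega>) = ?S \<omega>"
    using pos by eventually_elim (simp add: R_def q_block log_density_def ln_mult ln_div)
  have ints: "integrable M (log_density k n)" for k n using int log_density_shift(1) by blast
  have "integrable M ?S" by (intro Bochner_Integration.integrable_add Bochner_Integration.integrable_diff ints)
  then have int_R: "integrable M (\<lambda>\<omega>. ln (R \<omega>))"
    by (subst integrable_cong_AE[OF _ _ ln_R]) measurable
  have "(\<integral>\<omega>. ln (R \<omega>) \<partial>M) = (\<integral>\<omega>. ?S \<omega> \<partial>M)"
    by (rule integral_cong_AE[OF _ _ ln_R]) measurable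
  also have "\<dots> = (h (Suc m) - h m) - (h (Suc p) - h p)"
    using ints by (simp add: h_def log_density_shift(2)[of "m - p"])
  finally have eq: "(\<integral>\<omega>. ln (R \<omega>) \<partial>M) = (h (Suc m) - h m) - (h (Suc p) - h p)" .
  from integral_ln_nonpos(1)[OF _ R_pos R_le int_R] eq show "h (Suc m) - h m \<le> h (Suc p) - h p" by simp
  have "h (Suc m) - h m = h (Suc p) - h p \<longleftrightarrow> (AE \<omega> in M. R \<omega> = 1)"
    using integral_ln_nonpos(2)[OF _ R_pos R_le int_R] eq by simp
  also have "\<dots> \<longleftrightarrow> (AE x in lborel_pow (Suc m). 0 < f (Suc m) x \<longrightarrow> ?q x / f (Suc m) x = 1)"
    unfolding R_def by (rule AE_block_iff) measurable
  also have "\<dots> \<longleftrightarrow> (AE x in lborel_pow (Suc m). 0 < f (Suc m) x \<longrightarrow> ?q x = f (Suc m) x)"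
    by (rule AE_cong) auto
  also have "\<dots> \<longleftrightarrow> (AE x in lborel_pow (Suc m). ?q x = f (Suc m) x)"
  proof
    assume "AE x in lborel_pow (Suc m). 0 < f (Suc m) x \<longrightarrow> ?q x = f (Suc m) x"
    then show "AE x in lborel_pow (Suc m). ?q x = f (Suc m) x"
      \<comment> \<open>Both functions are probability densities, so agreement where
        \<open>f (Suc m)\<close> is positive suffices.\<close>
      by (intro AE_eq_f) (auto simp: memory_density_nonneg nn_integral_memory_density[OF pm])
  qed auto
  finally show "h (Suc m) - h m = h (Suc p) - h p \<longleftrightarrow> (AE x in lborel_pow (Suc m). ?q x = f (Suc m) x)" .
qed

text \<open>Both sides are equivalent to the entropy increments being constant from \<open>p\<close>
  on.\<close>

theorem has_memory_iff_entropy_rate: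
  assumes "\<bar>lim (\<lambda>n. block_entropy n / ereal (real n))\<bar> \<noteq> \<infinity>"
  shows "has_memory M p X \<longleftrightarrow> lim (\<lambda>n. block_entropy n / ereal (real n)) = block_entropy (Suc p) - block_entropy p"
proof -
  note int = integrable_log_density[OF assms]
  define h where "h n = - (\<integral>\<omega>. log_density 0 n \<omega> \<partial>M)" for n
  note increment = block_entropy_increment[OF _ int, folded h_def]
  have ent: "block_entropy n = ereal (h n)" for n
    unfolding h_def by (rule block_entropy_eq_integral[OF int])
  have "has_memory M p X \<longleftrightarrow> (\<forall>n\<ge>p. h (Suc n) - h n = h (Suc p) - h p)"
    unfolding has_memory_iff using increment(2) by blast
  also have "\<dots> \<longleftrightarrow> lim (\<lambda>n. ereal (h n) / ereal (real n)) = ereal (h (Suc p) - h p)"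
    \<comment> \<open>Concavity of \<open>h\<close> is the comparison of memory \<open>n\<close>
      with a past of length \<open>n + 1\<close>.\<close>
    by (rule lim_mean_eq_increment_iff[symmetric]) (rule increment(1), simp)
  finally show ?thesis unfolding ent by simp
qed

end

section \<open>The process of an invertible dynamical system\<close>

lemma distr_funpow:
  assumes T: "T \<in> M \<rightarrow>\<^sub>M M" and "distr M M T = M"
  shows "T ^^ k \<in> M \<rightarrow>\<^sub>M M" and "distr M M (T ^^ k) = M"
proof (induction k)
  case 0
  { case 1 show ?case by simp }
  { case 2 show ?case by (simp add: distr_id[unfolded id_def] id_def) }
next
  case (Suc k)
  { case 1 show ?case using measurable_comp[OF Suc(1) T] by (simp add: o_def) }
  { case 2 show ?case using distr_distr[OF T Suc(1)] Suc(2) assms(2) by (simp add: o_def distr_distr[OF T Suc(1)]) }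
qed

lemma stationary_density_process_orbit:
  assumes "invertible_dynamical_system M T" and F: "F \<in> AC M T"
  shows "stationary_density_process M (orbit_process T F)
    (\<lambda>n x. enn2real (RN_deriv (lborel_pow n) (block_law M T F n) x))"
proof -
  interpret prob_space M using assms(1) by (simp add: invertible_dynamical_system_def)
  have T: "T \<in> M \<rightarrow>\<^sub>M M" "distr M M T = M" using assms(1) by (auto simp: invertible_dynamical_system_def)
  note [measurable] = distr_funpow(1)[OF T]
  have [measurable]: "F \<in> borel_measurable M" and F2: "integrable M (\<lambda>\<omega>. (F \<omega>)\<^sup>2)"
    using F by (auto simp: AC_def)
  have X [measurable]: "orbit_process T F i \<in> borel_measurable M" for i
    unfolding orbit_process_def by measurable
  let ?block = "\<lambda>k n \<omega>. \<lambda>i\<in>{..<n}. orbit_process T F (k + i) \<omega>"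
  \<comment> \<open>\<open>AC\<close> speaks about \<open>n >= 1\<close>, while the locale includes
    \<open>n = 0\<close>. There the space is a single point with counting measure, and only the
    empty set is null.\<close>
  have ac: "absolutely_continuous (lborel_pow n) (block_law M T F n)" for n
  proof (cases "n = 0")
    case True
    then show ?thesis by (simp add: absolutely_continuous_def PiM_empty null_sets_count_space)
  qed (use F in \<open>simp add: AC_def\<close>)
  have law: "distr M (lborel_pow n) (?block k n) = block_law M T F n" for k n
  proof -
    have "?block k n = (\<lambda>\<omega>. ?block 0 n ((T ^^ k) \<omega>))"
      by (auto simp: orbit_process_def fun_eq_iff add.commute[of k] funpow_add)
    then have "distr M (lborel_pow n) (?block k n) = distr (distr M M (T ^^ k)) (lborel_pow n) (?block 0 n)"
      by (simp add: distr_distr o_def)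
    also have "\<dots> = block_law M T F n"
      by (simp add: distr_funpow(2)[OF T] block_law_def)
    finally show ?thesis .
  qed
  show ?thesis
  proof unfold_locales
    show "integrable M (\<lambda>\<omega>. (orbit_process T F i \<omega>)\<^sup>2)" for i
    proof -
      have "integrable (distr M M (T ^^ i)) (\<lambda>\<omega>. (F \<omega>)\<^sup>2)" using F2 by (simp add: distr_funpow(2)[OF T])
      then show ?thesis unfolding orbit_process_def by (subst (asm) integrable_distr_eq) simp_all
    qed
    fix k n
    interpret L: sigma_finite_measure "lborel_pow n" by (rule sigma_finite_lborel_pow)
    let ?P = "block_law M T F n"
    have P: "prob_space ?P" unfolding block_law_def by (rule prob_space_distr) measurable
    have sets: "sets ?P = sets (lborel_pow n)" by (simp add: block_law_def)
    \<comment> \<open>\<open>enn2real\<close> maps infinity to 0, so the real-valued version is a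
      density of the law because the derivative is finite almost everywhere.\<close>
    have "AE x in lborel_pow n. RN_deriv (lborel_pow n) ?P x \<noteq> \<infinity>"
      by (rule L.RN_deriv_finite[OF prob_space_imp_sigma_finite[OF P] ac sets])
    then have "density (lborel_pow n) (\<lambda>x. ennreal (enn2real (RN_deriv (lborel_pow n) ?P x))) =
        density (lborel_pow n) (RN_deriv (lborel_pow n) ?P)"
      by (intro density_cong) (auto elim!: eventually_mono simp: less_top)
    also have "\<dots> = ?P" by (rule L.density_RN_deriv[OF ac sets])
    finally show "distr M (lborel_pow n) (?block k n) =
        density (lborel_pow n) (\<lambda>x. ennreal (enn2real (RN_deriv (lborel_pow n) ?P x)))"
      by (simp add: law)
  qed (simp_all)
qed

theorem proposition4p23:
  fixes M :: "'a measure" and T :: "'a \<Rightarrow> 'a" and F :: "'a \<Rightarrow> real"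
  assumes "invertible_dynamical_system M T"
    and "F \<in> AC M T"
    and "\<bar>Se M T F\<bar> \<noteq> \<infinity>"
  shows "(Markovian M (orbit_process T F) \<longleftrightarrow> Se M T F = H M T 2 F - H M T 1 F) \<and>
    (\<forall>p::nat. p \<ge> 1 \<longrightarrow>
      (has_memory M p (orbit_process T F) \<longleftrightarrow> Se M T F = H M T (p + 1) F - H M T p F))"
proof -
  interpret stationary_density_process M "orbit_process T F"
    "\<lambda>n x. enn2real (RN_deriv (lborel_pow n) (block_law M T F n) x)"
    by (rule stationary_density_process_orbit[OF assms(1,2)])
  have H: "H M T n F = block_entropy n" for n by (simp add: H_def block_entropy_def)
  have iff: "has_memory M p (orbit_process T F) \<longleftrightarrow> Se M T F = H M T (p + 1) F - H M T p F" for p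
    using has_memory_iff_entropy_rate[of p] assms(3) by (simp add: Se_def H)
  from iff[of 1] have "Markovian M (orbit_process T F) \<longleftrightarrow> Se M T F = H M T 2 F - H M T 1 F"
    by (simp add: Markovian_def numeral_2_eq_2)
  with iff show ?thesis by blast
qed

end
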